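(* Let $q$ be a power of an odd prime and let $m=\frac{q+1}{2}$. For any $i\in\mathbb{Z}$ satisfying $1\le i\le (m-2)/2$ and $\gcd(i,m)=\gcd(i+2,m)=1$, the function fields $\mathcal{F}_i$ and $\mathcal{F}_{m-1}$ are non-isomorphic.
   Context: For $i\in\mathbb{Z}$ with $\gcd(i,m)=\gcd(i+2,m)=1$, $\mathcal{F}_i=\mathbb{F}_{q^2}(x,y)$ is the function field over $\mathbb{F}_{q^2}$ defined by $y^m=x^i(x^2+1)$ (the value $i=m-1$ always satisfies these conditions). Isomorphism is considered over the algebraic closure: $\mathcal{F}_i$ and $\mathcal{F}_j$ are isomorphic if the constant field extensions $\overline{\mathbb{F}}_{q^2}\mathcal{F}_i$ and $\overline{\mathbb{F}}_{q^2}\mathcal{F}_j$ are isomorphic by a field isomorphism that is the identity on $\overline{\mathbb{F}}_{q^2}$. *)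

theory Defs
  imports
    "HOL-Algebra.Algebraic_Closure_Type"
    "HOL-Algebra.Generated_Fields"
    "HOL-Algebra.QuotRing"
    "HOL-Computational_Algebra.Computational_Algebra"
begin

text \<open>
  All function fields are realised as subfields of one fixed algebraic closure of the rational
  function field \<open>k(x)\<close>, where the type \<open>'k\<close> plays the role of the base field \<open>k\<close>.
  This closure contains the roots \<open>y\<close> of \<open>Y^m = x^i (x^2 + 1)\<close>, hence the fields \<open>k(x, y)\<close>,
  and it contains an algebraic closure of \<open>k\<close>.
\<close>

type_synonym 'k ratfun_closure = "'k poly fract alg_closure"

abbreviation ambient :: "'k::field ratfun_closure ring" where
  "ambient \<equiv> ring_of_type_algebra"

definition const :: "'k::field \<Rightarrow> 'k ratfun_closure" where
  "const c = to_ac (Fraction_Field.Fract [:c:] 1)"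

definition gen_x :: "'k::field ratfun_closure" where
  "gen_x = to_ac (Fraction_Field.Fract [:0, 1:] 1)"

definition alg_constants :: "'k::field ratfun_closure set" where
  "alg_constants = {z. ring.algebraic ambient (range const) z}"

text \<open>
  \<open>F\<close> is the function field \<open>k(x, y)\<close> defined by \<open>y^m = x^i (x^2 + 1)\<close>. This is a relation
  and not a function of \<open>m\<close> and \<open>i\<close> because no choice is made among the roots \<open>y\<close> in the
  ambient closure. The exponent \<open>i\<close> may be negative.
\<close>

definition is_function_field :: "nat \<Rightarrow> int \<Rightarrow> 'k::field ratfun_closure set \<Rightarrow> bool" where
  "is_function_field m i F \<longleftrightarrow>
     (\<exists>y. y ^ m = gen_x powi i * (gen_x ^ 2 + 1) \<and>
          F = generate_field ambient (range const \<union> {gen_x, y}))"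

lemma is_function_field_exists:
  assumes "m > 0"
  shows "\<exists>F :: 'k::field ratfun_closure set. is_function_field m i F"
  using nth_root_exists[OF assms] unfolding is_function_field_def by blast

text \<open>The constant field extension of \<open>F\<close> is the compositum of \<open>F\<close> and the algebraic closure
  of \<open>k\<close>, formed in the ambient closure.\<close>

definition const_field_ext :: "'k::field ratfun_closure set \<Rightarrow> 'k ratfun_closure set" where
  "const_field_ext F = generate_field ambient (alg_constants \<union> F)"

definition isomorphic_over_closure ::
    "'k::field ratfun_closure set \<Rightarrow> 'k ratfun_closure set \<Rightarrow> bool" where
  "isomorphic_over_closure F G \<longleftrightarrow>
     (\<exists>h \<in> ring_iso (ambient\<lparr>carrier := const_field_ext F\<rparr>)
                    (ambient\<lparr>carrier := const_field_ext G\<rparr>).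
        \<forall>c \<in> alg_constants. h c = c)"

end

theory Submission
  imports Defs
begin

text \<open>
  Write \<open>K\<close> for the algebraic closure of the constant field and \<open>P = Z^(2 m) - 4\<close>. In the second field
  put \<open>z = y/x\<close> and \<open>w = x - 1/x\<close>. Then \<open>z^m = x + 1/x\<close>, so the field is \<open>K(z, w)\<close> with \<open>w^2 = P(z)\<close>:
  it is hyperelliptic of genus \<open>m - 1\<close>. An isomorphism yields generators \<open>u, t\<close> of \<open>K(z, w)\<close> with
  \<open>t^m = u^i (u^2 + 1)\<close>. Let \<open>e^2 = -1\<close> and \<open>f = t / (u - e)\<close>. The equation
  \<open>f^m (u - e)^(m - 1) = u^i (u + e)\<close> shows that \<open>K(z, w)\<close> has degree at most \<open>m - 1\<close> over \<open>K(f)\<close>.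
  On the other hand, an element \<open>f\<close> of \<open>K(z, w)\<close> outside \<open>K(z)\<close> satisfies a primitive quadratic
  equation over \<open>K[z]\<close> whose discriminant is a nonzero multiple of \<open>P\<close>, so that its coefficients
  have degree at least \<open>m\<close> in \<open>z\<close>, and this is the degree of \<open>z\<close> over \<open>K(f)\<close> (a special case of the
  Castelnuovo inequality). Hence \<open>t / (u - e)\<close> and \<open>t / (u + e)\<close> both lie in \<open>K(z)\<close>, so \<open>K(z)\<close>
  contains \<open>u\<close> and \<open>t\<close> and therefore \<open>w\<close>, although \<open>P\<close> is not a square.
\<close>

section \<open>Squarefree discriminants and inner degrees of bivariate polynomials\<close>

instance alg_closure :: (field) field_gcd ..

lemma coeff_mult_degree_le:
  fixes p q :: "'a::comm_semiring_0 poly"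
  assumes "degree p \<le> d" "degree q \<le> e"
  shows "coeff (p * q) (d + e) = coeff p d * coeff q e"
proof -
  have "coeff (p * q) (d + e) = (\<Sum>j\<le>d + e. if j = d then coeff p d * coeff q e else 0)"
    unfolding coeff_mult
  proof (rule sum.cong[OF refl])
    fix j assume "j \<in> {..d + e}"
    then show "coeff p j * coeff q (d + e - j) = (if j = d then coeff p d * coeff q e else 0)"
      using assms by (cases j d rule: linorder_cases) (auto simp: coeff_eq_0)
  qed
  then show ?thesis by simp
qed

text \<open>Here \<open>d\<close> is the degree in the inner variable, and the
  \<open>map_poly\<close> term is the leading coefficient of \<open>p\<close> read as a polynomial
  in that variable.\<close>

lemma poly_poly_inner_degree:
  fixes p :: "'a::comm_semiring_0 poly poly"
  assumes "p \<noteq> 0"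
  obtains d where "\<And>k. degree (coeff p k) \<le> d" "map_poly (\<lambda>c. coeff c d) p \<noteq> 0"
proof -
  define d where "d = Max ((\<lambda>k. degree (coeff p k)) ` {..degree p})"
  have le: "degree (coeff p k) \<le> d" for k
  proof (cases "k \<le> degree p")
    case True
    then show ?thesis unfolding d_def by (intro Max_ge) auto
  qed (simp add: coeff_eq_0)
  have "d \<in> (\<lambda>k. degree (coeff p k)) ` {..degree p}"
    unfolding d_def by (intro Max_in) auto
  then obtain k where k: "d = degree (coeff p k)" by blast
  have "\<exists>k. coeff (coeff p k) d \<noteq> 0"
  \<comment> \<open>Degree 0 does not distinguish a nonzero constant from the zero coefficient, so
    for \<open>d = 0\<close> the witness is the outer leading coefficient instead of the maximizing
    \<open>k\<close>.\<close>
  proof (cases "d = 0")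
    case True
    have "coeff p (degree p) \<noteq> 0" using assms by simp
    moreover have "degree (coeff p (degree p)) = 0" using le[of "degree p"] True by simp
    ultimately show ?thesis using True by (metis leading_coeff_0_iff)
  next
    case False
    then have "coeff p k \<noteq> 0" using k by auto
    then show ?thesis using k by (metis leading_coeff_0_iff)
  qed
  then have "map_poly (\<lambda>c. coeff c d) p \<noteq> 0"
    by (metis coeff_0 coeff_map_poly)
  with le show thesis by (rule that)
qed

text \<open>Over a domain the leading coefficients with respect to the inner variable have a nonzero
  product, so inner degrees add up and a factor cannot exceed the product.\<close>

lemma inner_degree_mult_left_le:
  fixes p q :: "'a::idom poly poly"
  assumes "p * q \<noteq> 0" and deg: "\<And>k. degree (coeff (p * q) k) \<le> n"
  shows "degree (coeff p k) \<le> n"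
proof -
  obtain d where d: "\<And>k. degree (coeff p k) \<le> d" "map_poly (\<lambda>c. coeff c d) p \<noteq> 0"
    using poly_poly_inner_degree[of p] assms(1) by auto
  obtain e where e: "\<And>k. degree (coeff q k) \<le> e" "map_poly (\<lambda>c. coeff c e) q \<noteq> 0"
    using poly_poly_inner_degree[of q] assms(1) by auto
  have "map_poly (\<lambda>c. coeff c (d + e)) (p * q)
      = map_poly (\<lambda>c. coeff c d) p * map_poly (\<lambda>c. coeff c e) q"
  proof (rule poly_eqI)
    fix k
    have "coeff (map_poly (\<lambda>c. coeff c (d + e)) (p * q)) k
        = (\<Sum>i\<le>k. coeff (coeff p i * coeff q (k - i)) (d + e))"
      by (simp only: coeff_map_poly coeff_0 coeff_mult[of p q] coeff_sum)
    also have "\<dots> = (\<Sum>i\<le>k. coeff (coeff p i) d * coeff (coeff q (k - i)) e)"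
      by (intro sum.cong refl coeff_mult_degree_le d e)
    also have "\<dots> = coeff (map_poly (\<lambda>c. coeff c d) p * map_poly (\<lambda>c. coeff c e) q) k"
      by (simp only: coeff_mult[of "map_poly _ p"] coeff_map_poly coeff_0)
    finally show "coeff (map_poly (\<lambda>c. coeff c (d + e)) (p * q)) k = \<dots>" .
  qed
  with d(2) e(2) have "map_poly (\<lambda>c. coeff c (d + e)) (p * q) \<noteq> 0" by simp
  then obtain k' where "coeff (map_poly (\<lambda>c. coeff c (d + e)) (p * q)) k' \<noteq> 0"
    using leading_coeff_neq_0 by blast
  then have "coeff (coeff (p * q) k') (d + e) \<noteq> 0"
    by (simp only: coeff_map_poly coeff_0 not_False_eq_True)
  then have "d + e \<le> n" using deg[of k'] by (meson le_degree order_trans)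
  then show ?thesis using d(1)[of k] by linarith
qed

text \<open>After division by \<open>gcd c s\<close> the cofactor \<open>c'\<close> is coprime to
  \<open>s'\<close>, so its square must divide \<open>P\<close>, which makes \<open>c'\<close> a
  unit.\<close>

lemma square_dvd_square_mult_squarefree:
  fixes c s P :: "'a::{factorial_ring_gcd,semiring_gcd_mult_normalize}"
  assumes "squarefree P" "c ^ 2 dvd s ^ 2 * P" "s \<noteq> 0"
  shows "c dvd s"
proof -
  have "gcd c s \<noteq> 0" using assms(3) by simp
  obtain c' s' where c': "c = c' * gcd c s" "s = s' * gcd c s" "coprime c' s'"
    using gcd_coprime_exists[OF \<open>gcd c s \<noteq> 0\<close>] by metis
  have "(gcd c s)^2 * c'^2 dvd (gcd c s)^2 * (s'^2 * P)"
    using assms(2) c'(1,2) by (metis mult.assoc mult.commute power_mult_distrib)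
  then have "c'^2 dvd s'^2 * P"
    using \<open>gcd c s \<noteq> 0\<close> by (metis dvd_times_left_cancel_iff power_not_zero)
  moreover have "coprime (c'^2) (s'^2)" using c'(3) by simp
  ultimately have "c'^2 dvd P" by (simp add: coprime_dvd_mult_right_iff)
  then have "is_unit c'" using assms(1) by (simp add: squarefree_def)
  then show ?thesis using c'(1,2) by (metis mult_dvd_mono dvd_refl unit_imp_dvd)
qed

text \<open>A factor occurring twice divides the derivative \<open>n Z^(n-1)\<close> as well, hence
  \<open>n Z^n\<close> and \<open>n (Z^n - b)\<close>, whose difference \<open>n b\<close> is a
  unit.\<close>

lemma squarefree_power_minus_const:
  fixes b :: "'a::field"
  assumes "of_nat n \<noteq> (0::'a)" "b \<noteq> 0"
  shows "squarefree (monom 1 n - [:b:])"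
proof (rule squarefreeI)
  fix x :: "'a poly" assume "x ^ 2 dvd monom 1 n - [:b:]"
  then obtain y where y: "monom 1 n - [:b:] = x ^ 2 * y" by (elim dvdE)
  have x: "x dvd monom 1 n - [:b:]" unfolding y power2_eq_square by simp
  have "pderiv (monom 1 n - [:b:]) = x * (x * pderiv y + 2 * pderiv x * y)"
    unfolding y by (simp add: pderiv_mult pderiv_power algebra_simps power2_eq_square)
  moreover have "pderiv (monom 1 n - [:b:]) = monom (of_nat n) (n - 1)"
    by (simp add: pderiv_diff pderiv_monom pderiv_pCons)
  ultimately have "x dvd monom (of_nat n) (n - 1)" by simp
  then have "x dvd monom 1 1 * monom (of_nat n) (n - 1)" by (rule dvd_mult)
  also have "monom 1 1 * monom (of_nat n) (n - 1) = smult (of_nat n) (monom (1::'a) n)"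
    using assms(1) by (cases n) (simp_all add: mult_monom smult_monom)
  finally have "x dvd smult (of_nat n) (monom (1::'a) n) - smult (of_nat n) (monom 1 n - [:b:])"
    using x by (meson dvd_diff dvd_smult)
  also have "\<dots> = [:of_nat n * b:]" by (simp add: smult_diff_right)
  finally have "x dvd [:of_nat n * b:]" .
  moreover have "is_unit [:of_nat n * b:]"
    using assms by (intro is_unit_triv) simp
  ultimately show "is_unit x" by (rule dvd_trans)
qed

text \<open>
  By Gauss's lemma the primitive part of the quadratic divides \<open>R\<close>. Its discriminant is still a
  multiple of \<open>P\<close> because the square of the content can only cancel against \<open>s\<^sup>2\<close>.
\<close>

lemma degree_le_of_quadratic_dvd:
  fixes \<alpha> \<beta> \<gamma> s P a :: "'a::field_gcd poly" and R :: "'a poly poly"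
  assumes dvd: "[:\<gamma>, \<beta>, \<alpha>:] dvd smult a R" and "a \<noteq> 0" "R \<noteq> 0" "\<alpha> \<noteq> 0"
    and deg: "\<And>k. degree (coeff R k) \<le> d"
    and disc: "\<beta> ^ 2 - 4 * \<alpha> * \<gamma> = s ^ 2 * P" and "s \<noteq> 0" "squarefree P"
  shows "degree P \<le> 2 * d"
proof -
  define c where "c = content [:\<gamma>, \<beta>, \<alpha>:]"
  define \<Phi> where "\<Phi> = primitive_part [:\<gamma>, \<beta>, \<alpha>:]"
  have \<Phi>: "[:\<gamma>, \<beta>, \<alpha>:] = smult c \<Phi>" "content \<Phi> = 1"
    using \<open>\<alpha> \<noteq> 0\<close> by (simp_all add: c_def \<Phi>_def)
  have "c \<noteq> 0" using \<Phi>(1) \<open>\<alpha> \<noteq> 0\<close> by auto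
  have "fract_poly \<Phi> dvd fract_poly R"
  proof -
    have "\<Phi> dvd smult a R" using dvd \<Phi>(1) \<open>c \<noteq> 0\<close> by (metis smult_dvd_cancel)
    then have "fract_poly \<Phi> dvd smult (to_fract a) (fract_poly R)"
      by (metis fract_poly_dvd fract_poly_smult)
    then show ?thesis using \<open>a \<noteq> 0\<close> by (simp add: dvd_smult_iff)
  qed
  then have "\<Phi> dvd R" using \<Phi>(2) by (rule fract_poly_dvdD)
  then obtain Q where Q: "R = \<Phi> * Q" by (elim dvdE)
  have deg\<Phi>: "degree (coeff \<Phi> k) \<le> d" for k
    using inner_degree_mult_left_le[of \<Phi> Q d k] \<open>R \<noteq> 0\<close> deg unfolding Q by blast
  have coeffs: "\<gamma> = c * coeff \<Phi> 0" "\<beta> = c * coeff \<Phi> 1" "\<alpha> = c * coeff \<Phi> 2"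
    using arg_cong[OF \<Phi>(1), of "\<lambda>p. coeff p 0"] arg_cong[OF \<Phi>(1), of "\<lambda>p. coeff p 1"]
      arg_cong[OF \<Phi>(1), of "\<lambda>p. coeff p 2"] by (simp_all add: numeral_2_eq_2)
  define D where "D = coeff \<Phi> 1 ^ 2 - 4 * coeff \<Phi> 2 * coeff \<Phi> 0"
  have D: "c ^ 2 * D = s ^ 2 * P"
    unfolding disc[symmetric] D_def coeffs by (simp add: algebra_simps power2_eq_square)
  then have "c dvd s"
    using square_dvd_square_mult_squarefree[OF \<open>squarefree P\<close> _ \<open>s \<noteq> 0\<close>] by (metis dvd_triv_left)
  then obtain t where t: "s = c * t" by (elim dvdE)
  have "c ^ 2 * D = c ^ 2 * (t ^ 2 * P)"
    unfolding D t by (simp add: power_mult_distrib mult.assoc)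
  then have Dt: "D = t ^ 2 * P" using \<open>c \<noteq> 0\<close> by simp
  have "P \<noteq> 0" "t \<noteq> 0" using \<open>squarefree P\<close> \<open>s \<noteq> 0\<close> t by auto
  then have "degree P \<le> degree D" unfolding Dt by (simp add: degree_mult_eq)
  also have "\<dots> \<le> 2 * d" unfolding D_def
  proof (rule degree_diff_le)
    show "degree (coeff \<Phi> 1 ^ 2) \<le> 2 * d"
      using degree_power_le[of "coeff \<Phi> 1" 2] deg\<Phi>[of 1] by linarith
    have "degree (coeff \<Phi> 2 * coeff \<Phi> 0) \<le> 2 * d"
      using degree_mult_le[of "coeff \<Phi> 2" "coeff \<Phi> 0"] deg\<Phi>[of 2] deg\<Phi>[of 0] by linarith
    moreover have "4 * coeff \<Phi> 2 * coeff \<Phi> 0 = smult 4 (coeff \<Phi> 2 * coeff \<Phi> 0)"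
      by (simp add: numeral_poly)
    ultimately show "degree (4 * coeff \<Phi> 2 * coeff \<Phi> 0) \<le> 2 * d"
      using degree_smult_le order_trans by metis
  qed
  finally show ?thesis .
qed

text \<open>Cancelling \<open>c\<close> would make \<open>P\<close> itself a square
  \<open>t ^ 2\<close>; squarefreeness then makes \<open>t\<close> a unit, against the positive
  degree.\<close>

lemma not_square_eq_square_mult:
  fixes a c P :: "'a::field_gcd poly"
  assumes "squarefree P" "degree P > 0" "c \<noteq> 0"
  shows "a ^ 2 \<noteq> c ^ 2 * P"
proof
  assume eq: "a ^ 2 = c ^ 2 * P"
  then have "c ^ 2 dvd a ^ 2" by simp
  then have "c dvd a" by simp
  then obtain t where t: "a = c * t" by (elim dvdE)
  have "t ^ 2 = P" using eq \<open>c \<noteq> 0\<close> unfolding t by (simp add: power_mult_distrib)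
  moreover from this have "is_unit t" using \<open>squarefree P\<close> by (auto simp: squarefree_def)
  ultimately show False using \<open>degree P > 0\<close>
    by (metis is_unit_iff_degree is_unit_power_iff less_numeral_extra(3) not_is_unit_0 zero_power2)
qed

section \<open>Subfields of a field type\<close>

context
begin

interpretation type_field: field "ring_of_type_algebra :: 'a::field ring"
  by (rule field_from_type_algebra)

lemma type_ring_simps [simp]:
  "carrier (ring_of_type_algebra :: 'a::field ring) = UNIV"
  "\<one>\<^bsub>ring_of_type_algebra\<^esub> = (1 :: 'a)"
  "\<zero>\<^bsub>ring_of_type_algebra\<^esub> = (0 :: 'a)"
  "x \<otimes>\<^bsub>ring_of_type_algebra\<^esub> y = x * (y :: 'a)"
  "x \<oplus>\<^bsub>ring_of_type_algebra\<^esub> y = x + (y :: 'a)"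
  by (simp_all add: ring_of_type_algebra_def)

lemma type_ring_a_inv [simp]: "\<ominus>\<^bsub>ring_of_type_algebra\<^esub> x = - (x :: 'a::field)"
  using type_field.minus_equality[of "- x" x] by simp

lemma type_ring_m_inv [simp]:
  "x \<noteq> 0 \<Longrightarrow> inv\<^bsub>ring_of_type_algebra\<^esub> x = inverse (x :: 'a::field)"
  by (rule type_field.comm_inv_char) simp_all

lemma type_ring_pow [simp]: "x [^]\<^bsub>ring_of_type_algebra\<^esub> (n::nat) = (x :: 'a::field) ^ n"
  by (induction n) (simp_all add: nat_pow_def mult.commute)

lemma type_subfieldI:
  fixes S :: "'a::field set"
  assumes "1 \<in> S" "\<And>x. x \<in> S \<Longrightarrow> - x \<in> S" "\<And>x y. x \<in> S \<Longrightarrow> y \<in> S \<Longrightarrow> x + y \<in> S"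
    "\<And>x y. x \<in> S \<Longrightarrow> y \<in> S \<Longrightarrow> x * y \<in> S" "\<And>x. x \<in> S \<Longrightarrow> x \<noteq> 0 \<Longrightarrow> inverse x \<in> S"
  shows "subfield S ring_of_type_algebra"
  using assms by (intro type_field.subfieldI' type_field.subringI) auto

context
  fixes S :: "'a::field set"
  assumes S: "subfield S ring_of_type_algebra"
begin

lemma subfield_0: "0 \<in> S" and subfield_1: "1 \<in> S"
  using subringE(2,3)[OF subfieldE(1)[OF S]] by simp_all

lemma subfield_uminus: "x \<in> S \<Longrightarrow> - x \<in> S"
  using subringE(5)[OF subfieldE(1)[OF S], of x] by simp

lemma subfield_add: "x \<in> S \<Longrightarrow> y \<in> S \<Longrightarrow> x + y \<in> S"
  and subfield_mult: "x \<in> S \<Longrightarrow> y \<in> S \<Longrightarrow> x * y \<in> S"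
  using subringE(6,7)[OF subfieldE(1)[OF S], of x y] by simp_all

lemma subfield_diff: "x \<in> S \<Longrightarrow> y \<in> S \<Longrightarrow> x - y \<in> S"
  using subfield_add[of x "- y"] subfield_uminus[of y] by simp

lemma subfield_inverse: "x \<in> S \<Longrightarrow> inverse x \<in> S"
  \<comment> \<open>At \<open>x = 0\<close> the convention \<open>inverse 0 = 0\<close> keeps the
    value in \<open>S\<close>.\<close>
  using type_field.subfield_m_inv(1)[OF S, of x] subfield_0 by (cases "x = 0") simp_all

lemma subfield_divide: "x \<in> S \<Longrightarrow> y \<in> S \<Longrightarrow> x / y \<in> S"
  by (simp add: divide_inverse subfield_mult subfield_inverse)

lemma subfield_power: "x \<in> S \<Longrightarrow> x ^ n \<in> S"
  by (induction n) (simp_all add: subfield_1 subfield_mult)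

lemma subfield_of_nat: "of_nat n \<in> S"
  by (induction n) (simp_all add: subfield_0 subfield_1 subfield_add)

lemma subfield_numeral: "numeral n \<in> S"
  using subfield_of_nat[of "numeral n"] by simp

lemma subfield_sum: "(\<And>i. i \<in> I \<Longrightarrow> f i \<in> S) \<Longrightarrow> sum f I \<in> S"
  by (induction I rule: infinite_finite_induct) (simp_all add: subfield_0 subfield_add)

lemmas subfield_closed = subfield_0 subfield_1 subfield_uminus subfield_add subfield_mult
  subfield_diff subfield_inverse subfield_divide subfield_power subfield_numeral subfield_sum

end

section \<open>Polynomials with coefficients in a subfield\<close>

definition polys_over :: "'a::zero set \<Rightarrow> 'a poly set" where
  "polys_over S = {p. \<forall>n. coeff p n \<in> S}"

lemma polys_over_coeff: "p \<in> polys_over S \<Longrightarrow> coeff p n \<in> S"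
  by (simp add: polys_over_def)

lemma polys_over_mono: "S \<subseteq> T \<Longrightarrow> polys_over S \<subseteq> polys_over T"
  by (auto simp: polys_over_def)

context
  fixes S :: "'a::field set"
  assumes S: "subfield S ring_of_type_algebra"
begin

lemma polys_over_0: "0 \<in> polys_over S"
  by (simp add: polys_over_def subfield_0[OF S])

lemma polys_over_1: "1 \<in> polys_over S"
  by (simp add: polys_over_def one_pCons coeff_pCons subfield_0[OF S] subfield_1[OF S]
      split: nat.splits)

lemma polys_over_pCons: "c \<in> S \<Longrightarrow> p \<in> polys_over S \<Longrightarrow> pCons c p \<in> polys_over S"
  by (simp add: polys_over_def coeff_pCons split: nat.splits)

lemma polys_over_monom: "c \<in> S \<Longrightarrow> monom c n \<in> polys_over S"
  by (simp add: polys_over_def subfield_0[OF S])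

lemma polys_over_add: "p \<in> polys_over S \<Longrightarrow> q \<in> polys_over S \<Longrightarrow> p + q \<in> polys_over S"
  by (simp add: polys_over_def subfield_add[OF S])

lemma polys_over_uminus: "p \<in> polys_over S \<Longrightarrow> - p \<in> polys_over S"
  by (simp add: polys_over_def subfield_uminus[OF S])

lemma polys_over_diff: "p \<in> polys_over S \<Longrightarrow> q \<in> polys_over S \<Longrightarrow> p - q \<in> polys_over S"
  by (simp add: polys_over_def subfield_diff[OF S])

lemma polys_over_mult: "p \<in> polys_over S \<Longrightarrow> q \<in> polys_over S \<Longrightarrow> p * q \<in> polys_over S"
  by (simp add: polys_over_def coeff_mult subfield_sum[OF S] subfield_mult[OF S])

lemma polys_over_power: "p \<in> polys_over S \<Longrightarrow> p ^ n \<in> polys_over S"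
  by (induction n) (simp_all add: polys_over_1 polys_over_mult)

lemma polys_over_prod: "(\<And>i. i \<in> I \<Longrightarrow> f i \<in> polys_over S) \<Longrightarrow> prod f I \<in> polys_over S"
  by (induction I rule: infinite_finite_induct) (simp_all add: polys_over_1 polys_over_mult)

lemma polys_over_numeral: "numeral n \<in> polys_over S"
  by (simp add: numeral_poly polys_over_pCons polys_over_0 subfield_numeral[OF S])

lemmas polys_over_closed = polys_over_0 polys_over_1 polys_over_pCons polys_over_monom
  polys_over_add polys_over_uminus polys_over_diff polys_over_mult polys_over_power
  polys_over_prod polys_over_numeral

lemma poly_in_subfield: "p \<in> polys_over S \<Longrightarrow> x \<in> S \<Longrightarrow> poly p x \<in> S"
  by (simp add: poly_altdef polys_over_coeff subfield_sum[OF S] subfield_mult[OF S]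
      subfield_power[OF S])

end

section \<open>Explicit elements of simple and of quadratic extensions\<close>

lemma subfield_fractions:
  fixes K :: "'a::field set"
  assumes K: "subfield K ring_of_type_algebra"
  shows "subfield {poly a t / poly c t | a c. a \<in> polys_over K \<and> c \<in> polys_over K \<and> poly c t \<noteq> 0}
    ring_of_type_algebra" (is "subfield ?S _")
proof (rule type_subfieldI)
  have I: "x \<in> ?S" if "x = poly a t / poly c t" "a \<in> polys_over K" "c \<in> polys_over K" "poly c t \<noteq> 0"
    for x a c using that by blast
  show "1 \<in> ?S" by (rule I[of _ 1 1]) (simp_all add: polys_over_1[OF K])
  fix x assume "x \<in> ?S"
  then obtain a c where x: "x = poly a t / poly c t" "a \<in> polys_over K" "c \<in> polys_over K" "poly c t \<noteq> 0"
    by blast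
  show "- x \<in> ?S"
    by (rule I[of _ "- a" c]) (use x in \<open>simp_all add: polys_over_uminus[OF K]\<close>)
  show "inverse x \<in> ?S" if "x \<noteq> 0"
    by (rule I[of _ c a]) (use x that in simp_all)
  fix y assume "y \<in> ?S"
  then obtain b d where y: "y = poly b t / poly d t" "b \<in> polys_over K" "d \<in> polys_over K" "poly d t \<noteq> 0"
    by blast
  show "x + y \<in> ?S"
    by (rule I[of _ "a * d + b * c" "c * d"])
      (use x(2-) y(2-) in \<open>simp_all add: x(1) y(1) polys_over_closed[OF K] field_simps\<close>)
  show "x * y \<in> ?S"
    by (rule I[of _ "a * b" "c * d"]) (use x y in \<open>simp_all add: polys_over_closed[OF K]\<close>)
qed

lemma generate_field_min:
  fixes H :: "'a::field set"
  assumes "subfield E ring_of_type_algebra" "H \<subseteq> E"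
  shows "generate_field ring_of_type_algebra H \<subseteq> E"
  using type_field.generate_field_min_subfield1[of H E] assms by simp

lemma generate_field_subfield:
  "subfield (generate_field ring_of_type_algebra (H :: 'a::field set)) ring_of_type_algebra"
  by (rule type_field.generate_field_is_subfield) simp

lemma generate_field_superset:
  "H \<subseteq> generate_field ring_of_type_algebra (H :: 'a::field set)"
  by (auto intro: generate_field.incl)

text \<open>The fractions evaluated at \<open>t\<close> form a field containing \<open>K\<close> and
  \<open>t\<close>, so minimality applies. Only the value of the denominator has to be nonzero,
  which covers algebraic as well as transcendental \<open>t\<close>.\<close>

lemma generate_field_insert_fraction:
  fixes K :: "'a::field set"
  assumes K: "subfield K ring_of_type_algebra"
    and "x \<in> generate_field ring_of_type_algebra (K \<union> {t})"
  obtains a c where "a \<in> polys_over K" "c \<in> polys_over K" "poly c t \<noteq> 0" "x = poly a t / poly c t"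
proof -
  let ?S = "{poly a t / poly c t | a c. a \<in> polys_over K \<and> c \<in> polys_over K \<and> poly c t \<noteq> 0}"
  have "y \<in> ?S" if "y \<in> K" for y
  proof -
    have "y = poly [:y:] t / poly 1 t" by simp
    then show ?thesis using that polys_over_1[OF K] polys_over_pCons[OF K _ polys_over_0[OF K]]
      by (smt (verit) mem_Collect_eq poly_1 zero_neq_one)
  qed
  moreover have "t \<in> ?S"
  proof -
    have "t = poly [:0, 1:] t / poly 1 t" by simp
    moreover have "[:0, 1:] \<in> polys_over K"
      by (intro polys_over_closed[OF K] subfield_0[OF K] subfield_1[OF K])
    ultimately show ?thesis using polys_over_1[OF K]
      by (smt (verit) mem_Collect_eq poly_1 zero_neq_one)
  qed
  ultimately have "generate_field ring_of_type_algebra (K \<union> {t}) \<subseteq> ?S"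
    by (intro generate_field_min subfield_fractions K) auto
  then show thesis using that assms(2) by blast
qed

text \<open>The elements \<open>u + v * w\<close> already form a field: inverses come from the
  conjugate \<open>u - v * w\<close>, since the product of the two is a norm in
  \<open>E\<close>.\<close>

lemma generate_field_insert_sqrt:
  fixes E :: "'a::field set"
  assumes E: "subfield E ring_of_type_algebra" and "w ^ 2 \<in> E" "w \<notin> E"
    and "x \<in> generate_field ring_of_type_algebra (E \<union> {w})"
  obtains u v where "u \<in> E" "v \<in> E" "x = u + v * w"
proof -
  let ?S = "{u + v * w | u v. u \<in> E \<and> v \<in> E}"
  have I: "y \<in> ?S" if "y = u + v * w" "u \<in> E" "v \<in> E" for y u v using that by blast
  have "subfield ?S ring_of_type_algebra"
  proof (rule type_subfieldI)
    show "1 \<in> ?S" by (rule I[of _ 1 0]) (simp_all add: subfield_closed[OF E])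
    fix x assume "x \<in> ?S"
    then obtain u v where x: "x = u + v * w" "u \<in> E" "v \<in> E" by blast
    show "- x \<in> ?S"
      by (rule I[of _ "- u" "- v"]) (use x in \<open>simp_all add: subfield_closed[OF E]\<close>)
    show "inverse x \<in> ?S" if "x \<noteq> 0"
    proof -
      \<comment> \<open>If the conjugate vanished with \<open>v\<close> nonzero, then
        \<open>w = u / v\<close> would lie in \<open>E\<close>.\<close>
      have ne: "u - v * w \<noteq> 0"
      proof
        assume *: "u - v * w = 0"
        show False
        proof (cases "v = 0")
          case True then show ?thesis using * x(1) \<open>x \<noteq> 0\<close> by simp
        next
          case False
          then have "w = u / v" using * by (simp add: field_simps)
          then show ?thesis using \<open>w \<notin> E\<close> subfield_divide[OF E x(2,3)] by simp
        qed
      qed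
      define n where "n = u ^ 2 - v ^ 2 * w ^ 2"
      have n: "n = x * (u - v * w)" unfolding n_def x(1) by (simp add: algebra_simps power2_eq_square)
      have "n \<noteq> 0" using n ne \<open>x \<noteq> 0\<close> by simp
      have "n \<in> E" unfolding n_def using x(2,3) \<open>w ^ 2 \<in> E\<close>
        by (simp add: subfield_diff[OF E] subfield_mult[OF E] subfield_power[OF E])
      have "inverse x = (u - v * w) / n" unfolding n using ne \<open>x \<noteq> 0\<close> by (simp add: field_simps)
      also have "\<dots> = u / n + (- v / n) * w" using \<open>n \<noteq> 0\<close> by (simp add: field_simps)
      finally show ?thesis
        by (rule I[of _ "u / n" "- v / n"])
          (use x(2,3) \<open>n \<in> E\<close> in \<open>auto intro!: subfield_divide[OF E] subfield_uminus[OF E]\<close>)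
    qed
    fix y assume "y \<in> ?S"
    then obtain u' v' where y: "y = u' + v' * w" "u' \<in> E" "v' \<in> E" by blast
    show "x + y \<in> ?S"
      by (rule I[of _ "u + u'" "v + v'"])
        (use x y in \<open>simp_all add: subfield_closed[OF E] algebra_simps\<close>)
    show "x * y \<in> ?S"
      by (rule I[of _ "u * u' + v * v' * w ^ 2" "u * v' + v * u'"])
        (use x y \<open>w ^ 2 \<in> E\<close> in \<open>simp_all add: subfield_closed[OF E] algebra_simps power2_eq_square\<close>)
  qed
  moreover have "y \<in> ?S" if "y \<in> E" for y
    by (rule I[of _ y 0]) (use that in \<open>simp_all add: subfield_0[OF E]\<close>)
  moreover have "w \<in> ?S"
    by (rule I[of _ 0 1]) (simp_all add: subfield_0[OF E] subfield_1[OF E])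
  ultimately have "generate_field ring_of_type_algebra (E \<union> {w}) \<subseteq> ?S"
    by (intro generate_field_min) auto
  then show thesis using that assms(4) by blast
qed

section \<open>Algebraic elements and degrees of their annihilating polynomials\<close>

lemma type_eval_conv_poly:
  "ring.eval ring_of_type_algebra xs (x :: 'a::field) = poly (Poly (rev xs)) x"
  by (induction xs) (simp_all add: Poly_append poly_monom mult.commute)

text \<open>Lists in \<open>univ_poly\<close> start with the leading coefficient, hence the
  reversal. A nonzero head means that \<open>Poly\<close> strips nothing; for the empty list the
  truncated \<open>0 - 1 = 0\<close> is the degree of the zero polynomial.\<close>

lemma Poly_rev_in_polys_over:
  fixes S :: "'a::field set"
  assumes "subfield S ring_of_type_algebra" "xs \<in> carrier (univ_poly ring_of_type_algebra S)"
  shows "Poly (rev xs) \<in> polys_over S" and "xs \<noteq> [] \<Longrightarrow> Poly (rev xs) \<noteq> 0"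
    and "degree (Poly (rev xs)) = length xs - 1"
proof -
  have xs: "xs = [] \<or> (set xs \<subseteq> S \<and> hd xs \<noteq> 0)"
    using assms(2) by (simp add: univ_poly_def polynomial_def)
  then show "Poly (rev xs) \<in> polys_over S"
    using subfield_0[OF assms(1)] by (auto simp: polys_over_def nth_default_def rev_nth)
  have "strip_while ((=) 0) (rev xs) = rev xs"
    using xs by (cases xs) simp_all
  then have "coeffs (Poly (rev xs)) = rev xs" by (simp add: coeffs_Poly)
  then show "xs \<noteq> [] \<Longrightarrow> Poly (rev xs) \<noteq> 0" "degree (Poly (rev xs)) = length xs - 1"
    by (metis coeffs_eq_Nil rev_is_Nil_conv, metis degree_eq_length_coeffs length_rev)
qed

lemma rev_coeffs_in_carrier:
  fixes S :: "'a::field set"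
  assumes "p \<in> polys_over S"
  shows "rev (coeffs p) \<in> carrier (univ_poly ring_of_type_algebra S)"
proof (cases "p = 0")
  case False
  then have "hd (rev (coeffs p)) \<noteq> 0"
    by (simp add: hd_rev last_coeffs_eq_coeff_degree)
  moreover have "set (coeffs p) \<subseteq> S"
    using assms by (auto simp: coeffs_def polys_over_def)
  ultimately show ?thesis by (simp add: univ_poly_def polynomial_def)
qed (simp add: univ_poly_def polynomial_def)

lemma type_algebraic_iff:
  fixes S :: "'a::field set"
  assumes S: "subfield S ring_of_type_algebra"
  shows "ring.algebraic ring_of_type_algebra S x \<longleftrightarrow> (\<exists>p \<in> polys_over S. p \<noteq> 0 \<and> poly p x = 0)"
proof
  assume "ring.algebraic ring_of_type_algebra S x"
  then obtain xs where "xs \<in> carrier (univ_poly ring_of_type_algebra S)" "xs \<noteq> []"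
    "ring.eval ring_of_type_algebra xs x = 0"
    using type_field.algebraicE[OF subfieldE(1)[OF S], of x] by (auto simp: over_def)
  then show "\<exists>p \<in> polys_over S. p \<noteq> 0 \<and> poly p x = 0"
    using Poly_rev_in_polys_over(1,2)[OF S] type_eval_conv_poly by metis
next
  assume "\<exists>p \<in> polys_over S. p \<noteq> 0 \<and> poly p x = 0"
  then obtain p where p: "p \<in> polys_over S" "p \<noteq> 0" "poly p x = 0" by blast
  then show "ring.algebraic ring_of_type_algebra S x"
    using type_field.algebraicI[OF rev_coeffs_in_carrier[OF p(1)], of x]
    by (simp add: type_eval_conv_poly over_def)
qed

text \<open>This transfers a degree bound from a generator to any element: the degree of
  \<open>z\<close> over \<open>E\<close> is at most the dimension of \<open>E(x)\<close>, which is
  at most \<open>degree p\<close>.\<close>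

lemma annihilator_degree_le:
  fixes E :: "'a::field set"
  assumes E: "subfield E ring_of_type_algebra"
    and p: "p \<in> polys_over E" "p \<noteq> 0" "poly p x = 0"
    and z: "z \<in> generate_field ring_of_type_algebra (E \<union> {x})"
  obtains q where "q \<in> polys_over E" "q \<noteq> 0" "poly q z = 0" "degree q \<le> degree p"
proof -
  let ?R = "ring_of_type_algebra :: 'a ring"
  let ?M = "ring.simple_extension ?R E x"
  have alg: "(ring.algebraic ?R over E) x"
    using type_algebraic_iff[OF E, of x] p by (auto simp: over_def)
  have M: "subfield ?M ?R"
    using type_field.simple_extension_is_subfield[OF E, of x] alg by simp
  have "E \<subseteq> ?M" using type_field.simple_extension_incl[of E x] by simp
  moreover have "x \<in> ?M" using type_field.simple_extension_mem[OF subfieldE(1)[OF E], of x] by simp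
  ultimately have "z \<in> ?M" using generate_field_min[OF M, of "E \<union> {x}"] z by blast
  then have algz: "(ring.algebraic ?R over E) z"
    using type_field.simple_extesion_mem_imp_algebraic[OF E _ alg] by simp
  let ?dx = "length (ring.Irr ?R E x) - 1" and ?dz = "length (ring.Irr ?R E z) - 1"
  \<comment> \<open>The minimal polynomial of \<open>x\<close> divides \<open>p\<close>.\<close>
  have "?dx \<le> length (rev (coeffs p)) - 1"
    using type_field.pdivides_imp_degree_le[OF subfieldE(1)[OF E]
        type_field.IrrE(1)[OF E _ alg] rev_coeffs_in_carrier[OF p(1)] _
        type_field.Irr_minimal[OF E _ alg rev_coeffs_in_carrier[OF p(1)]]] p(2,3)
    by (simp add: type_eval_conv_poly)
  also have "\<dots> = degree p" by (simp add: degree_eq_length_coeffs)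
  finally have dx: "?dx \<le> degree p" .
  have sub: "ring.simple_extension ?R E z \<subseteq> ?M"
    by (rule type_field.simple_extension_subring_incl[OF subfieldE(1)[OF M] \<open>E \<subseteq> ?M\<close> \<open>z \<in> ?M\<close>])
  \<comment> \<open>The powers of \<open>z\<close> below the degree of its minimal polynomial are
    independent and lie in \<open>E(x)\<close>, so their number is at most the dimension
    \<open>?dx\<close>.\<close>
  have "set (type_field.exp_base z ?dz) \<subseteq> ring.simple_extension ?R E z"
    using type_field.Span_base_incl[OF E, of "type_field.exp_base z ?dz"]
      type_field.Span_exp_base[OF E _ algz] by simp
  then have "length (type_field.exp_base z ?dz) \<le> ?dx"
    using type_field.independent_length_le_dimension[OF E
        type_field.dimension_simple_extension[OF E _ alg]
        type_field.exp_base_independent[OF E _ algz]] sub by auto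
  then have dz: "?dz \<le> ?dx" by (simp add: type_field.exp_base_def)
  have Irr: "ring.Irr ?R E z \<in> carrier (univ_poly ?R E)" "ring.eval ?R (ring.Irr ?R E z) z = 0"
    using type_field.IrrE(1,4)[OF E _ algz] by simp_all
  have "ring.Irr ?R E z \<noteq> []"
    using type_field.IrrE(2)[OF E _ algz] type_field.pirreducible_degree[OF E Irr(1)]
    by (metis type_ring_simps(1) UNIV_I list.size(3) diff_0_eq_0 not_one_le_zero)
  then show thesis
    using that[of "Poly (rev (ring.Irr ?R E z))"] Poly_rev_in_polys_over[OF E Irr(1)] Irr(2)
      dx dz by (simp add: type_eval_conv_poly)
qed

lemma subfield_algebraics:
  fixes k :: "'a::field set"
  assumes "subfield k ring_of_type_algebra"
  shows "subfield {z. ring.algebraic ring_of_type_algebra k z} ring_of_type_algebra"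
  using type_field.subfield_of_algebraics[OF assms] by (simp add: over_def)

text \<open>The finitely many coefficients of an annihilating polynomial generate a finite extension
  \<open>?M\<close> of \<open>k\<close>; then \<open>x\<close> lies in the simple extension of
  \<open>?M\<close> by \<open>x\<close>, which is finite over \<open>k\<close>.\<close>

lemma algebraic_over_algebraics:
  fixes k :: "'a::field set"
  assumes k: "subfield k ring_of_type_algebra"
    and x: "ring.algebraic ring_of_type_algebra {z. ring.algebraic ring_of_type_algebra k z} x"
  shows "ring.algebraic ring_of_type_algebra k x"
proof -
  let ?R = "ring_of_type_algebra :: 'a ring"
  let ?A = "{z. ring.algebraic ?R k z}"
  have A: "subfield ?A ?R" by (rule subfield_algebraics[OF k])
  obtain p where p: "p \<in> polys_over ?A" "p \<noteq> 0" "poly p x = 0"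
    using x type_algebraic_iff[OF A] by blast
  let ?M = "ring.finite_extension ?R k (coeffs p)"
  have algs: "(ring.algebraic ?R over k) c" if "c \<in> set (coeffs p)" for c
  proof -
    have "c \<in> range (coeff p)" using that by (simp add: range_coeff)
    then show ?thesis using p(1) by (auto simp: over_def polys_over_def)
  qed
  have M: "subfield ?M ?R"
    by (rule type_field.finite_extension_is_subfield[OF k]) (simp_all add: algs)
  have "set (coeffs p) \<subseteq> ?M"
    by (rule type_field.finite_extension_mem[OF subfieldE(1)[OF k]]) simp
  then have "range (coeff p) \<subseteq> ?M"
    unfolding range_coeff using subfield_0[OF M] by blast
  then have "p \<in> polys_over ?M" by (auto simp: polys_over_def)
  then have alg: "(ring.algebraic ?R over ?M) x"
    using type_algebraic_iff[OF M] p(2,3) by (auto simp: over_def)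
  have "ring.finite_dimension ?R k ?M"
    by (rule type_field.finite_extension_finite_dimension(1)[OF k]) (simp_all add: algs)
  moreover have "ring.finite_dimension ?R ?M (ring.simple_extension ?R ?M x)"
    using type_field.finite_dimension_simple_extension[OF M, of x] alg by simp
  ultimately have "ring.finite_dimension ?R k (ring.simple_extension ?R ?M x)"
    by (rule type_field.telescopic_base_dim(1)[OF k M])
  then have "(ring.algebraic ?R over k) x"
    using type_field.finite_dimension_imp_algebraic[OF k
        type_field.simple_extension_is_subring[OF subfieldE(1)[OF M]]]
      type_field.simple_extension_mem[OF subfieldE(1)[OF M]] by simp
  then show ?thesis by (simp add: over_def)
qed

end

section \<open>Elements of a hyperelliptic field outside the rational subfield\<close>

text \<open>From \<open>w = a(z) / c(z)\<close> and the transcendence of \<open>z\<close> follows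
  the polynomial identity \<open>a ^ 2 = c ^ 2 * P\<close>, impossible for squarefree
  \<open>P\<close> of positive degree.\<close>

lemma not_in_rational_function_field:
  fixes K :: "'a::field_gcd set"
  assumes K: "subfield K ring_of_type_algebra"
    and tr: "\<And>p. p \<in> polys_over K \<Longrightarrow> poly p z = 0 \<Longrightarrow> p = 0"
    and P: "P \<in> polys_over K" "squarefree P" "degree P > 0" and w: "w ^ 2 = poly P z"
  shows "w \<notin> generate_field ring_of_type_algebra (K \<union> {z})"
proof
  assume "w \<in> generate_field ring_of_type_algebra (K \<union> {z})"
  then obtain a c where ac: "a \<in> polys_over K" "c \<in> polys_over K" "poly c z \<noteq> 0"
    "w = poly a z / poly c z"
    by (rule generate_field_insert_fraction[OF K])
  have "poly (a ^ 2 - c ^ 2 * P) z = 0"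
    using w ac(3) unfolding ac(4) by (simp add: power_divide divide_simps)
  then have "a ^ 2 - c ^ 2 * P = 0"
    by (intro tr polys_over_closed[OF K] ac P)
  moreover have "c \<noteq> 0" using ac(3) by auto
  ultimately show False using not_square_eq_square_mult[OF P(2,3)] by simp
qed

lemma quadratic_equation_with_discriminant:
  fixes K :: "'a::field set"
  assumes K: "subfield K ring_of_type_algebra"
    and P: "P \<in> polys_over K" and w: "w ^ 2 = poly P z"
    and wnot: "w \<notin> generate_field ring_of_type_algebra (K \<union> {z})" and two: "(2::'a) \<noteq> 0"
    and f: "f \<in> generate_field ring_of_type_algebra (K \<union> {z, w})"
    and fnot: "f \<notin> generate_field ring_of_type_algebra (K \<union> {z})"
  obtains \<alpha> \<beta> \<gamma> s where "\<alpha> \<in> polys_over K" "\<beta> \<in> polys_over K" "\<gamma> \<in> polys_over K"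
    "\<alpha> \<noteq> 0" "s \<noteq> 0" "\<beta> ^ 2 - 4 * \<alpha> * \<gamma> = s ^ 2 * P"
    "poly \<alpha> z * f ^ 2 + poly \<beta> z * f + poly \<gamma> z = 0"
proof -
  let ?E = "generate_field ring_of_type_algebra (K \<union> {z})"
  have E: "subfield ?E ring_of_type_algebra" by (rule generate_field_subfield)
  have sub: "K \<union> {z} \<subseteq> ?E" by (rule generate_field_superset)
  have "w ^ 2 \<in> ?E"
    unfolding w using P sub polys_over_mono[of K ?E] by (intro poly_in_subfield[OF E]) auto
  moreover have "f \<in> generate_field ring_of_type_algebra (?E \<union> {w})"
  proof -
    have "K \<union> {z, w} \<subseteq> generate_field ring_of_type_algebra (?E \<union> {w})"
      using sub generate_field_superset[of "?E \<union> {w}"] by blast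
    then show ?thesis using f generate_field_min[OF generate_field_subfield] by blast
  qed
  ultimately obtain u v where uv: "u \<in> ?E" "v \<in> ?E" "f = u + v * w"
    using generate_field_insert_sqrt[OF E _ wnot] by metis
  obtain a c where ac: "a \<in> polys_over K" "c \<in> polys_over K" "poly c z \<noteq> 0" "u = poly a z / poly c z"
    using uv(1) by (rule generate_field_insert_fraction[OF K])
  obtain b d where bd: "b \<in> polys_over K" "d \<in> polys_over K" "poly d z \<noteq> 0" "v = poly b z / poly d z"
    using uv(2) by (rule generate_field_insert_fraction[OF K])
  have "b \<noteq> 0" using fnot uv(1,3) bd(4) by auto
  have "c \<noteq> 0" "d \<noteq> 0" using ac(3) bd(3) by auto
  have two': "(2 :: 'a poly) \<noteq> 0" using two by (simp add: numeral_poly)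
  \<comment> \<open>With \<open>f = a/c + (b/d) w\<close>, the quadratic comes from expanding
    \<open>(c d f - a d)^2 = (b c)^2 P\<close>. Since \<open>f\<close> is not in
    \<open>K(z)\<close>, \<open>b\<close> and hence \<open>s = 2 (b c) (c d)\<close> are
    nonzero.\<close>
  show thesis
  proof (rule that[of "(c * d) ^ 2" "- 2 * (a * d) * (c * d)" "(a * d) ^ 2 - (b * c) ^ 2 * P"
        "2 * (b * c) * (c * d)"])
    show "(c * d) ^ 2 \<in> polys_over K" "- 2 * (a * d) * (c * d) \<in> polys_over K"
      "(a * d) ^ 2 - (b * c) ^ 2 * P \<in> polys_over K"
      by (intro polys_over_closed[OF K] ac bd P)+
    show "(c * d) ^ 2 \<noteq> 0" "2 * (b * c) * (c * d) \<noteq> 0"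
      using \<open>b \<noteq> 0\<close> \<open>c \<noteq> 0\<close> \<open>d \<noteq> 0\<close> two' by simp_all
    show "(- 2 * (a * d) * (c * d)) ^ 2 - 4 * (c * d) ^ 2 * ((a * d) ^ 2 - (b * c) ^ 2 * P)
        = (2 * (b * c) * (c * d)) ^ 2 * P"
      by (simp add: algebra_simps power2_eq_square)
    have cdf: "poly c z * poly d z * f = poly a z * poly d z + poly b z * poly c z * w"
      using ac(3) bd(3) unfolding uv(3) ac(4) bd(4) by (simp add: field_simps)
    have "(poly c z * poly d z * f - poly a z * poly d z) ^ 2 = (poly b z * poly c z) ^ 2 * poly P z"
      unfolding cdf w[symmetric] by (simp add: power_mult_distrib)
    then show "poly ((c * d) ^ 2) z * f ^ 2 + poly (- 2 * (a * d) * (c * d)) z * f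
        + poly ((a * d) ^ 2 - (b * c) ^ 2 * P) z = 0"
      by (simp add: algebra_simps power2_eq_square)
  qed
qed

text \<open>The leading coefficient \<open>\<alpha>\<close> need not be a unit, so every division
  step costs a factor \<open>\<alpha>\<close>. The remainder is kept over \<open>K\<close> because
  it will be evaluated at \<open>z\<close>.\<close>

lemma quadratic_pseudo_division:
  fixes K :: "'a::field set"
  assumes K: "subfield K ring_of_type_algebra"
    and \<alpha>\<beta>\<gamma>: "\<alpha> \<in> polys_over K" "\<beta> \<in> polys_over K" "\<gamma> \<in> polys_over K"
    and "\<And>k. coeff R k \<in> polys_over K"
  shows "\<exists>n Q t0 t1. t0 \<in> polys_over K \<and> t1 \<in> polys_over K \<and>
    smult (\<alpha> ^ n) R = [:\<gamma>, \<beta>, \<alpha>:] * Q + [:t0, t1:]"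
  using assms(5)
proof (induction R)
  case 0
  show ?case
    by (rule exI[of _ 0], rule exI[of _ 0], rule exI[of _ 0], rule exI[of _ 0])
      (simp add: polys_over_0[OF K])
next
  case (pCons c R)
  have c: "c \<in> polys_over K" using pCons.prems[of 0] by simp
  have "coeff R k \<in> polys_over K" for k using pCons.prems[of "Suc k"] by simp
  then obtain n Q t0 t1 where t: "t0 \<in> polys_over K" "t1 \<in> polys_over K"
    and R: "smult (\<alpha> ^ n) R = [:\<gamma>, \<beta>, \<alpha>:] * Q + [:t0, t1:]"
    using pCons.IH by blast
  have "smult (\<alpha> ^ Suc n) (pCons c R) = smult \<alpha> (pCons (\<alpha> ^ n * c) (smult (\<alpha> ^ n) R))"
    by (simp add: mult.assoc)
  \<comment> \<open>Shifting the remainder creates a quadratic term with coefficient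
    \<open>t1\<close>; after scaling by \<open>\<alpha>\<close> it is removed by \<open>t1\<close>
    times the quadratic.\<close>
  also have "\<dots> = [:\<gamma>, \<beta>, \<alpha>:] * (smult \<alpha> (pCons 0 Q) + [:t1:])
      + [:\<alpha> ^ Suc n * c - t1 * \<gamma>, \<alpha> * t0 - t1 * \<beta>:]"
    unfolding R by (simp add: algebra_simps smult_add_right)
  finally have "smult (\<alpha> ^ Suc n) (pCons c R) = \<dots>" .
  moreover have "\<alpha> ^ Suc n * c - t1 * \<gamma> \<in> polys_over K" "\<alpha> * t0 - t1 * \<beta> \<in> polys_over K"
    by (intro polys_over_closed[OF K] t c \<alpha>\<beta>\<gamma>)+
  ultimately show ?case by blast
qed

text \<open>With \<open>z\<close> as the inner and \<open>f\<close> as the outer variable, Gauss's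
  lemma applies to polynomials in \<open>f\<close> over polynomials in \<open>z\<close>.\<close>

definition eval2 :: "'a::comm_semiring_0 poly poly \<Rightarrow> 'a \<Rightarrow> 'a \<Rightarrow> 'a" where
  "eval2 R z f = poly (map_poly (\<lambda>c. poly c z) R) f"

lemma eval2_pCons [simp]: "eval2 (pCons c R) z f = poly c z + f * eval2 R z f"
  by (simp add: eval2_def map_poly_pCons)

lemma eval2_0 [simp]: "eval2 0 z f = 0"
  by (simp add: eval2_def)

lemma eval2_add [simp]:
  "eval2 (p + q) z f = eval2 p z f + eval2 q z (f :: 'a::comm_ring_1)"
  by (induction p q rule: poly_induct2) (simp_all add: algebra_simps)

lemma eval2_smult [simp]: "eval2 (smult c p) z f = poly c z * eval2 p z (f :: 'a::comm_ring_1)"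
  by (induction p) (simp_all add: algebra_simps)

lemma eval2_mult [simp]: "eval2 (p * q) z f = eval2 p z f * eval2 q z (f :: 'a::comm_ring_1)"
  by (induction p) (simp_all add: algebra_simps)

lemma eval2_sum [simp]: "eval2 (\<Sum>i\<in>I. p i) z f = (\<Sum>i\<in>I. eval2 (p i) z (f :: 'a::comm_ring_1))"
  by (induction I rule: infinite_finite_induct) simp_all

lemma eval2_map_monom:
  "eval2 (map_poly (\<lambda>a. monom a j) r) z f = z ^ j * poly r (f :: 'a::comm_ring_1)"
  by (induction r) (simp_all add: map_poly_pCons poly_monom algebra_simps)

text \<open>Multiplying \<open>q\<close> by all its denominators gives a polynomial in both
  variables. Sorting it by powers of \<open>f\<close> instead of \<open>z\<close> turns
  \<open>degree q\<close> into a bound on the inner degree.\<close>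

lemma clear_denominators:
  fixes K :: "'a::field set"
  assumes K: "subfield K ring_of_type_algebra"
    and q: "q \<in> polys_over (generate_field ring_of_type_algebra (K \<union> {f}))" "q \<noteq> 0" "poly q z = 0"
  obtains R where "R \<noteq> 0" "\<And>k. coeff R k \<in> polys_over K" "\<And>k. degree (coeff R k) \<le> degree q"
    "eval2 R z f = 0"
proof -
  have "\<exists>a c. a \<in> polys_over K \<and> c \<in> polys_over K \<and> poly c f \<noteq> 0 \<and> coeff q j = poly a f / poly c f" for j
    using generate_field_insert_fraction[OF K polys_over_coeff[OF q(1), of j]] by metis
  then obtain a c where ac: "\<And>j. a j \<in> polys_over K" "\<And>j. c j \<in> polys_over K"
    "\<And>j. poly (c j) f \<noteq> 0" "\<And>j. coeff q j = poly (a j) f / poly (c j) f"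
    by metis
  let ?d = "degree q"
  define r where "r j = a j * (\<Prod>i\<in>{..?d} - {j}. c i)" for j
  define C where "C = (\<Prod>i\<le>?d. poly (c i) f)"
  have "C \<noteq> 0" by (simp add: C_def ac)
  have r: "poly (r j) f = C * coeff q j" if "j \<le> ?d" for j
  proof -
    have "C = poly (c j) f * (\<Prod>i\<in>{..?d} - {j}. poly (c i) f)"
      unfolding C_def using that by (intro prod.remove) auto
    then show ?thesis using ac(3)[of j] by (simp add: r_def poly_prod ac(4))
  qed
  have rK: "r j \<in> polys_over K" for j
    unfolding r_def by (intro polys_over_closed[OF K] ac)
  \<comment> \<open>The monomials \<open>monom a j\<close> interchange the variables:
    \<open>r j\<close> becomes the part of \<open>R\<close> with inner exponent
    \<open>j\<close>.\<close>
  define R where "R = (\<Sum>j\<le>?d. map_poly (\<lambda>a. monom a j) (r j))"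
  have coeff_R: "coeff R k = (\<Sum>j\<le>?d. monom (coeff (r j) k) j)" for k
    by (simp add: R_def coeff_sum coeff_map_poly)
  have coeff_coeff_R: "coeff (coeff R k) n = (if n \<le> ?d then coeff (r n) k else 0)" for k n
    by (simp add: coeff_R coeff_sum)
  show thesis
  proof (rule that)
    show "R \<noteq> 0"
    proof
      assume "R = 0"
      then have "coeff (r ?d) k = 0" for k using coeff_coeff_R[of k ?d] by simp
      then have "r ?d = 0" by (simp add: poly_eq_iff)
      then show False using r[of ?d] \<open>C \<noteq> 0\<close> \<open>q \<noteq> 0\<close> by simp
    qed
    show "coeff R k \<in> polys_over K" for k
      using polys_over_coeff[OF rK] subfield_0[OF K] by (simp add: polys_over_def coeff_coeff_R)
    show "degree (coeff R k) \<le> ?d" for k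
      by (rule degree_le) (simp add: coeff_coeff_R)
    have "eval2 R z f = (\<Sum>j\<le>?d. C * (coeff q j * z ^ j))"
      by (simp add: R_def eval2_map_monom r algebra_simps)
    also have "\<dots> = C * poly q z" by (simp add: poly_altdef sum_distrib_left)
    finally show "eval2 R z f = 0" using q(3) by simp
  qed
qed

text \<open>
  Polynomials over \<open>K\<close> are kept inside \<open>'a poly\<close>: evaluation at \<open>(z, f)\<close> needs coefficients in \<open>K\<close>,
  but Gauss's lemma may be applied over the whole type.
\<close>

lemma degree_over_nonrational_element:
  fixes K :: "'a::field_gcd set"
  assumes K: "subfield K ring_of_type_algebra"
    and tr: "\<And>p. p \<in> polys_over K \<Longrightarrow> poly p z = 0 \<Longrightarrow> p = 0"
    and P: "P \<in> polys_over K" "squarefree P" "degree P > 0" and w: "w ^ 2 = poly P z"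
    and two: "(2::'a) \<noteq> 0"
    and f: "f \<in> generate_field ring_of_type_algebra (K \<union> {z, w})"
    and fnot: "f \<notin> generate_field ring_of_type_algebra (K \<union> {z})"
    and q: "q \<in> polys_over (generate_field ring_of_type_algebra (K \<union> {f}))" "q \<noteq> 0" "poly q z = 0"
  shows "degree P \<le> 2 * degree q"
proof -
  obtain \<alpha> \<beta> \<gamma> s where \<alpha>\<beta>\<gamma>: "\<alpha> \<in> polys_over K" "\<beta> \<in> polys_over K" "\<gamma> \<in> polys_over K"
    and ne: "\<alpha> \<noteq> 0" "s \<noteq> 0" and disc: "\<beta> ^ 2 - 4 * \<alpha> * \<gamma> = s ^ 2 * P"
    and root: "poly \<alpha> z * f ^ 2 + poly \<beta> z * f + poly \<gamma> z = 0"
    using quadratic_equation_with_discriminant[OF K P(1) w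
        not_in_rational_function_field[OF K tr P w] two f fnot] by metis
  obtain R where R: "R \<noteq> 0" "\<And>k. coeff R k \<in> polys_over K"
    "\<And>k. degree (coeff R k) \<le> degree q" "eval2 R z f = 0"
    using clear_denominators[OF K q] by metis
  \<comment> \<open>The relation \<open>R(z, f) = 0\<close> is divided by the quadratic for
    \<open>f\<close>. A nonzero \<open>t1\<close> would give \<open>f = - t0(z) / t1(z)\<close> in
    \<open>K(z)\<close>, so the remainder vanishes and the quadratic divides a multiple of
    \<open>R\<close>.\<close>
  obtain n Q t0 t1 where t: "t0 \<in> polys_over K" "t1 \<in> polys_over K"
    and div: "smult (\<alpha> ^ n) R = [:\<gamma>, \<beta>, \<alpha>:] * Q + [:t0, t1:]"
    using quadratic_pseudo_division[OF K \<alpha>\<beta>\<gamma> R(2)] by blast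
  have "eval2 [:\<gamma>, \<beta>, \<alpha>:] z f = 0"
    using root by (simp add: algebra_simps power2_eq_square)
  then have lin: "poly t0 z + f * poly t1 z = 0"
    using arg_cong[OF div, of "\<lambda>p. eval2 p z f"]
    by (simp only: eval2_add eval2_mult eval2_smult R(4)) simp
  have "t1 = 0"
  proof (rule ccontr)
    assume "t1 \<noteq> 0"
    then have "poly t1 z \<noteq> 0" using tr t(2) by blast
    then have "f = - poly t0 z / poly t1 z"
      using lin by (simp add: field_simps eq_neg_iff_add_eq_0)
    moreover have "poly p z \<in> generate_field ring_of_type_algebra (K \<union> {z})"
      if "p \<in> polys_over K" for p
      using that polys_over_mono[of K "generate_field ring_of_type_algebra (K \<union> {z})"]
        generate_field_superset[of "K \<union> {z}"]
      by (intro poly_in_subfield generate_field_subfield) auto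
    ultimately show False
      using fnot t subfield_divide[OF generate_field_subfield] subfield_uminus[OF generate_field_subfield]
      by metis
  qed
  moreover from this have "t0 = 0" using lin tr t(1) by simp
  ultimately have "smult (\<alpha> ^ n) R = [:\<gamma>, \<beta>, \<alpha>:] * Q"
    unfolding div by simp
  then have "[:\<gamma>, \<beta>, \<alpha>:] dvd smult (\<alpha> ^ n) R" by (rule dvdI)
  then show ?thesis
    using degree_le_of_quadratic_dvd[OF _ _ R(1) ne(1) R(3) disc ne(2) P(2)] ne(1) by simp
qed

section \<open>The ambient closure and its constants\<close>

text \<open>Translation by 1 permutes the elements, so adding 1 to each of them does not change
  their sum.\<close>

lemma of_nat_card_UNIV_eq_0:
  assumes "finite (UNIV :: 'a::ring_1 set)"
  shows "of_nat (card (UNIV :: 'a set)) = (0 :: 'a)"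
proof -
  have "(\<Sum>a\<in>UNIV. a) = (\<Sum>a\<in>UNIV. a + (1 :: 'a))"
    by (rule sum.reindex_bij_witness[of _ "\<lambda>a. a + 1" "\<lambda>a. a - 1"]) auto
  then show ?thesis by (simp add: sum.distrib)
qed

lemma const_hom [simp]:
  fixes a b :: "'k::field"
  shows "const (0 :: 'k) = 0" "const (1 :: 'k) = 1" "const (a + b) = const a + const b"
    "const (a * b) = const a * const b" "const (- a) = - const a"
    and const_inverse: "const (inverse a) = inverse (const a)"
proof -
  show 0: "const (0 :: 'k) = 0" and 1: "const (1 :: 'k) = 1"
    by (simp_all add: const_def fract_collapse flip: one_pCons)
  show "const (a + b) = const a + const b"
    by (simp add: const_def flip: to_ac_add)
  show mult: "const (a * b) = const a * const b" for a b :: 'k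
    by (simp add: const_def mult.commute flip: to_ac_mult)
  show "const (- a) = - const a"
    by (simp add: const_def flip: to_ac_minus)
  show "const (inverse a) = inverse (const a)"
  proof (cases "a = 0")
    case False
    then have "const a * const (inverse a) = 1" by (simp add: 1 flip: mult)
    then show ?thesis by (simp add: inverse_unique)
  qed (simp add: 0)
qed

lemma const_of_nat [simp]: "const (of_nat n) = of_nat n"
  by (induction n) simp_all

lemma const_eq_iff [simp]: "const a = const b \<longleftrightarrow> a = b"
  by (simp add: const_def eq_fract)

lemma subfield_range_const:
  "subfield (range (const :: 'k::field \<Rightarrow> _)) ring_of_type_algebra"
  by (rule type_subfieldI) (auto simp flip: const_hom const_inverse)

lemma poly_map_const_gen_x: "poly (map_poly const p) gen_x = to_ac (Fraction_Field.Fract p 1)"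
proof (induction p)
  case (pCons a p)
  have "Fraction_Field.Fract (pCons a p) 1
      = Fraction_Field.Fract [:a:] 1 + Fraction_Field.Fract [:0, 1:] 1 * Fraction_Field.Fract p 1"
    by simp
  then have "to_ac (Fraction_Field.Fract (pCons a p) 1)
      = const a + gen_x * to_ac (Fraction_Field.Fract p 1)"
    unfolding const_def gen_x_def by (metis to_ac_add to_ac_mult)
  then show ?case using pCons.IH by (simp add: map_poly_pCons)
qed (simp add: fract_collapse)

lemma gen_x_transcendental:
  "\<not> ring.algebraic (ambient :: 'k::field ratfun_closure ring) (range const) gen_x"
proof
  assume "ring.algebraic (ambient :: 'k ratfun_closure ring) (range const) gen_x"
  then obtain p :: "'k ratfun_closure poly"
    where p: "p \<in> polys_over (range const)" "p \<noteq> 0" "poly p gen_x = 0"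
    using type_algebraic_iff[OF subfield_range_const] by blast
  \<comment> \<open>An algebraic relation for \<open>gen_x\<close> is pulled back along the
    injective \<open>const\<close>; its value at \<open>gen_x\<close> is then \<open>p0\<close>
    itself as a fraction.\<close>
  define p0 where "p0 = map_poly (inv_into UNIV (const :: 'k \<Rightarrow> _)) p"
  have inv0: "inv_into UNIV (const :: 'k \<Rightarrow> _) 0 = 0"
    by (metis const_hom(1) const_eq_iff f_inv_into_f rangeI)
  have "map_poly const p0 = p"
  proof (rule poly_eqI)
    fix n
    show "coeff (map_poly const p0) n = coeff p n"
      unfolding p0_def using polys_over_coeff[OF p(1), of n]
      by (simp add: coeff_map_poly inv0 f_inv_into_f)
  qed
  then have "p0 = 0" using poly_map_const_gen_x[of p0] p(3)
    by (simp add: eq_fract Zero_fract_def)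
  then show False using \<open>map_poly const p0 = p\<close> \<open>p \<noteq> 0\<close> by simp
qed

lemma subfield_alg_constants: "subfield alg_constants (ambient :: 'k::field ratfun_closure ring)"
  unfolding alg_constants_def by (rule subfield_algebraics[OF subfield_range_const])

text \<open>Transitivity of algebraicity makes the constants algebraically closed inside the ambient
  field. This supplies a square root of -1 and the transcendence of \<open>z\<close>.\<close>

lemma alg_constants_root:
  fixes z :: "'k::field ratfun_closure"
  assumes "p \<in> polys_over alg_constants" "p \<noteq> 0" "poly p z = 0"
  shows "z \<in> alg_constants"
  using assms algebraic_over_algebraics[OF subfield_range_const]
    type_algebraic_iff[OF subfield_alg_constants, of z]
  unfolding alg_constants_def by blast

lemma gen_x_notin_alg_constants: "gen_x \<notin> (alg_constants :: 'k::field ratfun_closure set)"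
  using gen_x_transcendental by (simp add: alg_constants_def)

lemma range_const_subset: "range const \<subseteq> (alg_constants :: 'k::field ratfun_closure set)"
proof
  fix c :: "'k ratfun_closure" assume "c \<in> range const"
  then show "c \<in> alg_constants"
    unfolding alg_constants_def mem_Collect_eq type_algebraic_iff[OF subfield_range_const]
    using subfield_range_const
    by (intro bexI[of _ "[:- c, 1:]"]) (auto intro!: polys_over_closed subfield_closed)
qed

lemma const_field_ext_generate_field:
  "const_field_ext (generate_field ambient (range const \<union> A)) = generate_field ambient (alg_constants \<union> A)"
  unfolding const_field_ext_def
proof (intro antisym generate_field_min generate_field_subfield)
  let ?L = "generate_field ambient (alg_constants \<union> A)"
  have "generate_field ambient (range const \<union> A) \<subseteq> ?L"
    using range_const_subset generate_field_superset[of "alg_constants \<union> A"]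
    by (intro generate_field_min generate_field_subfield) blast
  then show "alg_constants \<union> generate_field ambient (range const \<union> A) \<subseteq> ?L"
    using generate_field_superset[of "alg_constants \<union> A"] by blast
  show "alg_constants \<union> A
      \<subseteq> generate_field ambient (alg_constants \<union> generate_field ambient (range const \<union> A))"
    using generate_field_superset[of "range const \<union> A"]
      generate_field_superset[of "alg_constants \<union> generate_field ambient (range const \<union> A)"] by blast
qed

text \<open>The elements of \<open>M\<close> that \<open>h\<close> sends into \<open>T\<close> form
  a field containing \<open>H\<close>. For a surjective \<open>h\<close> this shows that the images
  of generators generate the target.\<close>

lemma ring_hom_generate_field_image:
  fixes H :: "'a::field set" and h :: "'a \<Rightarrow> 'a"
  defines "M \<equiv> generate_field ring_of_type_algebra H"
  assumes add: "\<And>a b. a \<in> M \<Longrightarrow> b \<in> M \<Longrightarrow> h (a + b) = h a + h b"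
    and mult: "\<And>a b. a \<in> M \<Longrightarrow> b \<in> M \<Longrightarrow> h (a * b) = h a * h b"
    and one: "h 1 = 1"
    and T: "subfield T ring_of_type_algebra" and H: "h ` H \<subseteq> T"
  shows "h ` M \<subseteq> T"
proof -
  have M: "subfield M ring_of_type_algebra" unfolding M_def by (rule generate_field_subfield)
  have zero: "h 0 = 0" using add[OF subfield_0 subfield_0, OF M M] by (metis add_0_left add_cancel_right_left)
  have uminus: "h (- a) = - h a" if "a \<in> M" for a
    using add[of a "- a"] that subfield_uminus[OF M] zero by (simp add: eq_neg_iff_add_eq_0 add.commute)
  have inverse: "h (inverse a) = inverse (h a)" if "a \<in> M" "a \<noteq> 0" for a
    using mult[of a "inverse a"] that subfield_inverse[OF M] one inverse_unique[of "h a"] by simp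
  have "subfield {a \<in> M. h a \<in> T} ring_of_type_algebra"
    by (rule type_subfieldI)
      (auto simp: add mult one uminus inverse subfield_closed[OF M] subfield_closed[OF T])
  moreover have "H \<subseteq> {a \<in> M. h a \<in> T}"
    using H generate_field_superset[of H] unfolding M_def by blast
  ultimately have "M \<subseteq> {a \<in> M. h a \<in> T}"
    unfolding M_def by (rule generate_field_min)
  then show ?thesis by blast
qed

section \<open>Non-isomorphism\<close>

text \<open>Otherwise two bounds on the degree of \<open>z\<close> over \<open>K(f)\<close> clash:
  at most \<open>m - 1\<close> by the equation of \<open>u\<close>, at least \<open>m\<close> since
  \<open>P\<close> has degree \<open>2 * m\<close>. As \<open>e\<close> is any square root of -1,
  the sign can be changed.\<close>

lemma fraction_in_rational_function_field:
  fixes K :: "'a::field_gcd set"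
  assumes K: "subfield K ring_of_type_algebra"
    and tr: "\<And>p. p \<in> polys_over K \<Longrightarrow> poly p z = 0 \<Longrightarrow> p = 0"
    and P: "P \<in> polys_over K" "squarefree P" "degree P = 2 * m" and w: "w ^ 2 = poly P z"
    and two: "(2::'a) \<noteq> 0" and m: "i + 2 < m"
    and u: "u \<in> generate_field ring_of_type_algebra (K \<union> {z, w})" "u \<notin> K"
    and t: "t \<in> generate_field ring_of_type_algebra (K \<union> {z, w})" "t ^ m = u ^ i * (u ^ 2 + 1)"
    and z: "z \<in> generate_field ring_of_type_algebra (K \<union> {u, t})"
    and e: "e \<in> K" "e ^ 2 = - 1"
  shows "t / (u - e) \<in> generate_field ring_of_type_algebra (K \<union> {z})"
proof (rule ccontr)
  define f where "f = t / (u - e)"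
  let ?L = "generate_field ring_of_type_algebra (K \<union> {z, w})"
  let ?E = "generate_field ring_of_type_algebra (K \<union> {f})"
  assume "t / (u - e) \<notin> generate_field ring_of_type_algebra (K \<union> {z})"
  then have fnot: "f \<notin> generate_field ring_of_type_algebra (K \<union> {z})" by (simp add: f_def)
  have L: "subfield ?L ring_of_type_algebra" and E: "subfield ?E ring_of_type_algebra"
    by (rule generate_field_subfield)+
  have "u \<noteq> e" "u \<noteq> - e" "u \<noteq> 0"
    using u(2) e(1) subfield_uminus[OF K] subfield_0[OF K] by auto
  have factor: "u ^ 2 + 1 = (u - e) * (u + e)"
    using e(2) by (simp add: algebra_simps power2_eq_square)
  have "t \<noteq> 0"
  proof
    assume "t = 0"
    then have "u ^ i * (u ^ 2 + 1) = 0" using t(2) m by (simp add: zero_power)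
    then show False
      using \<open>u \<noteq> e\<close> \<open>u \<noteq> - e\<close> \<open>u \<noteq> 0\<close> unfolding factor by (simp add: eq_neg_iff_add_eq_0)
  qed
  then have "f \<noteq> 0" using \<open>u \<noteq> e\<close> by (simp add: f_def)
  have tf: "t = f * (u - e)" using \<open>u \<noteq> e\<close> by (simp add: f_def)
  have fL: "f \<in> ?L"
    unfolding f_def using u(1) t(1) e(1) generate_field_superset[of "K \<union> {z, w}"]
    by (intro subfield_divide[OF L] subfield_diff[OF L]) auto
  \<comment> \<open>These are the two sides of \<open>f^m (u - e)^(m - 1) = u^i (u + e)\<close> as
    polynomials in \<open>u\<close>. As \<open>i + 1 < m - 1\<close>, their leading terms cannot
    cancel.\<close>
  define A B where "A = [:- e, 1:] ^ (m - 1)" and "B = [:0, 1:] ^ i * [:e, 1:]"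
  define p where "p = smult (f ^ m) A - B"
  have degA: "degree A = m - 1" by (simp add: A_def degree_linear_power)
  have "degree B = i + 1"
    unfolding B_def by (subst degree_mult_eq) (simp_all add: degree_power_eq)
  then have "degree B < m - 1" using m by simp
  have "p \<noteq> 0"
  proof
    assume "p = 0"
    then have "degree (smult (f ^ m) A) = degree B" by (simp add: p_def)
    then show False using degA \<open>degree B < m - 1\<close> \<open>f \<noteq> 0\<close> by simp
  qed
  have degp: "degree p \<le> m - 1"
    unfolding p_def using degA \<open>degree B < m - 1\<close> by (intro degree_diff_le) auto
  have KE: "K \<union> {f} \<subseteq> ?E" by (rule generate_field_superset)
  have "p \<in> polys_over ?E"
  proof -
    have eE: "e \<in> ?E" "f \<in> ?E" using KE e(1) by auto
    have "[:- e, 1:] \<in> polys_over ?E" "[:0, 1:] \<in> polys_over ?E" "[:e, 1:] \<in> polys_over ?E"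
        "[:f ^ m:] \<in> polys_over ?E"
      by (intro polys_over_closed[OF E] subfield_closed[OF E] eE)+
    moreover have "p = [:f ^ m:] * A - B" by (simp add: p_def)
    ultimately show ?thesis unfolding A_def B_def
      by (simp only: polys_over_diff[OF E] polys_over_mult[OF E] polys_over_power[OF E])
  qed
  moreover have "poly p u = 0"
  proof -
    have "poly p u = f ^ m * (u - e) ^ (m - 1) - u ^ i * (u + e)"
      by (simp add: p_def A_def B_def algebra_simps)
    then have "(u - e) * poly p u
        = f ^ m * ((u - e) * (u - e) ^ (m - 1)) - u ^ i * ((u - e) * (u + e))"
      by (simp only: right_diff_distrib mult.left_commute)
    also have "(u - e) * (u - e) ^ (m - 1) = (u - e) ^ m"
      using m by (cases m) simp_all
    also have "f ^ m * (u - e) ^ m - u ^ i * ((u - e) * (u + e)) = 0"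
      using t(2) unfolding tf factor by (simp add: power_mult_distrib)
    finally show ?thesis using \<open>u \<noteq> e\<close> by simp
  qed
  \<comment> \<open>Over \<open>K(f)\<close> the element \<open>u\<close> alone generates
    \<open>t = f (u - e)\<close> and with it \<open>z\<close>, so the bound for \<open>u\<close>
    passes to \<open>z\<close>.\<close>
  moreover have "z \<in> generate_field ring_of_type_algebra (?E \<union> {u})"
  proof -
    let ?M = "generate_field ring_of_type_algebra (?E \<union> {u})"
    have M: "subfield ?M ring_of_type_algebra" by (rule generate_field_subfield)
    have sub: "?E \<union> {u} \<subseteq> ?M" by (rule generate_field_superset)
    then have "t \<in> ?M"
      unfolding tf using KE e(1) by (intro subfield_mult[OF M] subfield_diff[OF M]) auto
    then have "K \<union> {u, t} \<subseteq> ?M" using sub KE by blast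
    then show ?thesis using z generate_field_min[OF M] by blast
  qed
  ultimately obtain q where q: "q \<in> polys_over ?E" "q \<noteq> 0" "poly q z = 0" "degree q \<le> degree p"
    using annihilator_degree_le[OF E _ \<open>p \<noteq> 0\<close>] by metis
  have "degree P > 0" using P(3) m by simp
  then have "degree P \<le> 2 * degree q"
    using degree_over_nonrational_element[OF K tr P(1,2) _ w two fL fnot q(1-3)] by blast
  then show False using P(3) q(4) degp m by simp
qed

lemma hyperelliptic_not_superelliptic:
  fixes K :: "'a::field_gcd set"
  assumes K: "subfield K ring_of_type_algebra"
    and tr: "\<And>p. p \<in> polys_over K \<Longrightarrow> poly p z = 0 \<Longrightarrow> p = 0"
    and P: "P \<in> polys_over K" "squarefree P" "degree P = 2 * m" and w: "w ^ 2 = poly P z"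
    and two: "(2::'a) \<noteq> 0" and m: "i + 2 < m"
    and u: "u \<in> generate_field ring_of_type_algebra (K \<union> {z, w})" "u \<notin> K"
    and t: "t \<in> generate_field ring_of_type_algebra (K \<union> {z, w})"
    and eq: "t ^ m = u ^ i * (u ^ 2 + 1)"
    and e: "e \<in> K" "e ^ 2 = - 1"
  shows "\<not> {z, w} \<subseteq> generate_field ring_of_type_algebra (K \<union> {u, t})"
proof
  assume zw: "{z, w} \<subseteq> generate_field ring_of_type_algebra (K \<union> {u, t})"
  then have z: "z \<in> generate_field ring_of_type_algebra (K \<union> {u, t})" by simp
  let ?E = "generate_field ring_of_type_algebra (K \<union> {z})"
  have E: "subfield ?E ring_of_type_algebra" by (rule generate_field_subfield)
  have KE: "K \<subseteq> ?E" using generate_field_superset[of "K \<union> {z}"] by blast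
  have e': "- e \<in> K" "(- e) ^ 2 = - 1" using e subfield_uminus[OF K] by simp_all
  define f g where "f = t / (u - e)" and "g = t / (u - - e)"
  have f: "f \<in> ?E" and g: "g \<in> ?E"
    unfolding f_def g_def
    using fraction_in_rational_function_field[OF K tr P w two m u t eq z] e e' by blast+
  have ne: "u - e \<noteq> 0" "u + e \<noteq> 0" "e \<noteq> 0"
    using u(2) e e'(1) by (auto simp: eq_neg_iff_add_eq_0[symmetric])
  have "u \<in> ?E" "t \<in> ?E"
  proof -
    have tf: "t = f * (u - e)" and tg: "t = g * (u + e)"
      using ne by (simp_all add: f_def g_def)
    \<comment> \<open>Eliminating \<open>t\<close> leaves a linear equation for \<open>u\<close>
      over \<open>K(z)\<close>. Its leading coefficient is nonzero: \<open>f = g\<close> forces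
      \<open>t = 0\<close>, so \<open>u\<close> would be one of the constants 0, \<open>e\<close>,
      \<open>- e\<close>.\<close>
    then have lin: "(f - g) * u = (f + g) * e" by (simp add: algebra_simps)
    have "f \<noteq> g"
    proof
      assume "f = g"
      then have "2 * g * e = 0" using lin by simp
      then have "t = 0" using two ne(3) tg by simp
      then have "u ^ i * (u ^ 2 + 1) = 0" using eq m by (simp add: zero_power)
      moreover have "u ^ 2 + 1 = (u - e) * (u + e)"
        using e(2) by (simp add: algebra_simps power2_eq_square)
      ultimately have "u = 0" using ne by simp
      then show False using u(2) subfield_0[OF K] by simp
    qed
    then have u': "u = (f + g) * e / (f - g)" using lin by (simp add: field_simps)
    have "(f + g) * e / (f - g) \<in> ?E"
      using f g e(1) KE by (intro subfield_closed[OF E]) auto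
    then show "u \<in> ?E" using u' by simp
    then show "t \<in> ?E"
      unfolding tf using f e(1) KE by (intro subfield_closed[OF E]) auto
  qed
  then have "generate_field ring_of_type_algebra (K \<union> {u, t}) \<subseteq> ?E"
    using KE by (intro generate_field_min[OF E]) auto
  then have "w \<in> ?E" using zw by blast
  moreover have "degree P > 0" using P(3) m by simp
  ultimately show False using not_in_rational_function_field[OF K tr P(1,2) _ w] by blast
qed

theorem theorem5p1:
  fixes p n q m :: nat and i :: int
    and F G :: "'k::field ratfun_closure set"
  assumes "Factorial_Ring.prime p" and "odd p" and "n \<ge> 1" and "q = p ^ n"
    and "card (UNIV :: 'k set) = q ^ 2"
    and "m = (q + 1) div 2"
    and "1 \<le> i" and "real_of_int i \<le> (real m - 2) / 2"
    and "gcd i (int m) = 1" and "gcd (i + 2) (int m) = 1"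
    and "is_function_field m i F"
    and "is_function_field m (int m - 1) G"
  shows "\<not> isomorphic_over_closure F G"
proof
  assume "isomorphic_over_closure F G"
  then obtain h where h: "h \<in> ring_iso (ambient\<lparr>carrier := const_field_ext F\<rparr>)
      (ambient\<lparr>carrier := const_field_ext G\<rparr>)" and h_const: "\<And>c. c \<in> alg_constants \<Longrightarrow> h c = c"
    unfolding isomorphic_over_closure_def by blast
  note Un_insert_right [simp del]
  let ?K = "alg_constants :: 'k ratfun_closure set" and ?x = "gen_x :: 'k ratfun_closure"
  note K = subfield_alg_constants[where 'k = 'k]

  \<comment> \<open>Exponents and characteristic\<close>
  obtain j where j: "i = int j" using \<open>1 \<le> i\<close> nonneg_int_cases[of i] by auto
  have m: "j + 2 < m" 
  proof -
    have "real (2 * j + 2) \<le> real m" using assms(8) unfolding j by simp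
    then have "2 * j + 2 \<le> m" by (simp only: of_nat_le_iff)
    \<comment> \<open>Since \<open>j\<close> is at least 1,
      \<open>j + 2 < 2 * j + 2\<close>.\<close>
    then show ?thesis using \<open>1 \<le> i\<close> unfolding j by linarith
  qed
  have "odd q" using \<open>odd p\<close> \<open>q = p ^ n\<close> by simp
  then have qm: "q + 1 = 2 * m" using \<open>m = (q + 1) div 2\<close> by simp
  have "q > 0" using \<open>odd q\<close> by (cases q) auto
  have "finite (UNIV :: 'k set)" using assms(5) \<open>q > 0\<close> card.infinite[of "UNIV :: 'k set"] by force
  \<comment> \<open>The cardinality \<open>q ^ 2\<close> of the base field is zero in it, so
    \<open>2 m = q + 1\<close> equals 1 in the ambient field. Both 2 and \<open>2 m\<close> are
    therefore nonzero there.\<close>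
  then have "(of_nat q :: 'k) ^ 2 = 0"
    using of_nat_card_UNIV_eq_0[where 'a = 'k] assms(5) by simp
  then have "const (of_nat q :: 'k) = const 0" by simp
  then have "(of_nat q :: 'k ratfun_closure) = 0" by (simp only: const_of_nat const_hom)
  then have two_m: "of_nat (2 * m) = (1 :: 'k ratfun_closure)"
    unfolding qm[symmetric] by simp
  then have two: "(2 :: 'k ratfun_closure) \<noteq> 0" by auto

  obtain y where y: "y ^ m = ?x ^ j * (?x ^ 2 + 1)"
    and F: "F = generate_field ambient (range const \<union> {?x, y})"
    using \<open>is_function_field m i F\<close> unfolding is_function_field_def j by auto
  have int_m: "int m - 1 = int (m - 1)" using m by simp
  obtain v where v: "v ^ m = ?x ^ (m - 1) * (?x ^ 2 + 1)"
    and G: "G = generate_field ambient (range const \<union> {?x, v})"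
    using \<open>is_function_field m (int m - 1) G\<close> unfolding is_function_field_def int_m by auto
  let ?F = "generate_field ambient (?K \<union> {?x, y})" and ?G = "generate_field ambient (?K \<union> {?x, v})"
  have carriers: "const_field_ext F = ?F" "const_field_ext G = ?G"
    unfolding F G by (rule const_field_ext_generate_field)+
  have hom: "h (a * b) = h a * h b" "h (a + b) = h a + h b" if "a \<in> ?F" "b \<in> ?F" for a b
    using h that unfolding carriers by (auto simp: ring_iso_def ring_hom_def)
  have bij: "bij_betw h ?F ?G"
    using h unfolding carriers by (simp add: ring_iso_def)
  have one: "h 1 = 1" by (rule h_const) (rule subfield_1[OF K])

  \<comment> \<open>The hyperelliptic model of the second field\<close>
  have x0: "?x \<noteq> 0" using gen_x_notin_alg_constants subfield_0[OF K] by metis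
  define z where "z = v / ?x"
  define w where "w = ?x - 1 / ?x"
  define P :: "'k ratfun_closure poly" where "P = monom 1 (2 * m) - [:4:]"
  have zm: "z ^ m = ?x + 1 / ?x"
  proof -
    have "?x ^ m = ?x * ?x ^ (m - 1)" using m by (cases m) simp_all
    then have "z ^ m = (?x ^ (m - 1) * (?x ^ 2 + 1)) / (?x ^ (m - 1) * ?x)"
      unfolding z_def power_divide v by (simp only: mult.commute)
    also have "\<dots> = (?x ^ 2 + 1) / ?x" using x0 by simp
    also have "\<dots> = ?x + 1 / ?x" using x0 by (simp add: add_divide_distrib power2_eq_square)
    finally show ?thesis .
  qed
  have w: "w ^ 2 = poly P z"
  proof -
    have "w ^ 2 = (?x + 1 / ?x) ^ 2 - 4"
      unfolding w_def power2_sum power2_diff using x0 by simp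
    moreover have "poly P z = (z ^ m) ^ 2 - 4"
      unfolding P_def power_even_eq[symmetric] by (simp add: poly_monom)
    ultimately show ?thesis unfolding zm by simp
  qed
  have P: "P \<in> polys_over ?K"
    unfolding P_def by (intro polys_over_closed[OF K] subfield_closed[OF K])
  have four: "(4 :: 'k ratfun_closure) \<noteq> 0"
    using two by (metis mult_eq_0_iff numeral_Bit0 mult_2)
  have "squarefree P"
    unfolding P_def using two_m four by (intro squarefree_power_minus_const) simp_all
  have "degree P = 2 * m"
    unfolding P_def diff_conv_add_uminus
    by (subst degree_add_eq_left) (use m in \<open>simp_all add: degree_monom_eq\<close>)
  \<comment> \<open>If \<open>z\<close> were a constant, then \<open>?x\<close> would be one too, as
    a root of \<open>X^2 - z^m X + 1\<close>.\<close>
  have tr: "p = 0" if "p \<in> polys_over ?K" "poly p z = 0" for p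
  proof (rule ccontr)
    assume "p \<noteq> 0"
    then have "z \<in> ?K" by (rule alg_constants_root[OF that(1) _ that(2)])
    then have "[:1, - (z ^ m), 1:] \<in> polys_over ?K"
      by (intro polys_over_closed[OF K] subfield_closed[OF K])
    moreover have "[:1, - (z ^ m), 1:] \<noteq> 0" by simp
    moreover have "poly [:1, - (z ^ m), 1:] ?x = 0"
      unfolding zm using x0 by (simp add: algebra_simps)
    ultimately have "?x \<in> ?K" by (rule alg_constants_root)
    then show False using gen_x_notin_alg_constants by blast
  qed
  have G_eq: "?G \<subseteq> generate_field ambient (?K \<union> {z, w})" (is "_ \<subseteq> ?M")
  proof (rule generate_field_min[OF generate_field_subfield])
    have M: "subfield ?M ambient" by (rule generate_field_subfield)
    have sub: "?K \<union> {z, w} \<subseteq> ?M" by (rule generate_field_superset)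
    \<comment> \<open>The generators are recovered by adding \<open>w = x - 1/x\<close> and
      \<open>z^m = x + 1/x\<close>.\<close>
    have "?x = (w + z ^ m) / 2" unfolding w_def zm using two by simp
    moreover have "(w + z ^ m) / 2 \<in> ?M" using sub by (intro subfield_closed[OF M]) auto
    ultimately have x: "?x \<in> ?M" by (rule ssubst)
    have "v = z * ?x" using x0 by (simp add: z_def)
    then have "v \<in> ?M" using sub x subfield_mult[OF M] by auto
    then show "?K \<union> {?x, v} \<subseteq> ?M" using sub x by blast
  qed

  \<comment> \<open>Transport of the first field into the second\<close>
  define u t where "u = h ?x" and "t = h y"
  have F': "subfield ?F ambient" by (rule generate_field_subfield)
  have mem: "?K \<union> {?x, y} \<subseteq> ?F" by (rule generate_field_superset)
  have pow: "h (a ^ k) = h a ^ k" if "a \<in> ?F" for a k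
    using that by (induction k) (simp_all add: one hom subfield_power[OF F'])
  have eq: "t ^ m = u ^ j * (u ^ 2 + 1)"
  proof -
    have "h (y ^ m) = h (?x ^ j * (?x ^ 2 + 1))" unfolding y ..
    then show ?thesis
      using mem by (simp add: u_def t_def pow hom one subfield_add[OF F'] subfield_mult[OF F']
          subfield_power[OF F'] subfield_1[OF F'])
  qed
  have ut: "u \<in> ?G" "t \<in> ?G"
    using bij_betw_apply[OF bij] mem by (auto simp: u_def t_def)
  \<comment> \<open>A constant \<open>u\<close> would be fixed by \<open>h\<close>, so injectivity
    would give \<open>u = ?x\<close>, which is not a constant.\<close>
  have "u \<notin> ?K"
  proof
    assume "u \<in> ?K"
    then have "h u = h ?x" using h_const u_def by simp
    then have "u = ?x"
      using bij_betw_imp_inj_on[OF bij] mem \<open>u \<in> ?K\<close> by (auto dest: inj_onD)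
    then show False using \<open>u \<in> ?K\<close> gen_x_notin_alg_constants by blast
  qed
  have "?G \<subseteq> generate_field ambient (?K \<union> {u, t})" (is "_ \<subseteq> ?T")
  proof -
    have "h ` ?F \<subseteq> ?T"
      using generate_field_superset[of "?K \<union> {u, t}"] h_const
      by (intro ring_hom_generate_field_image hom one generate_field_subfield)
        (auto simp: u_def t_def)
    then show ?thesis using bij_betw_imp_surj_on[OF bij] by simp
  qed
  moreover have "{z, w} \<subseteq> ?G"
  proof -
    have G': "subfield ?G ambient" by (rule generate_field_subfield)
    have xv: "?x \<in> ?G" "v \<in> ?G" using generate_field_superset[of "?K \<union> {?x, v}"] by auto
    have "z \<in> ?G" "w \<in> ?G" unfolding z_def w_def by (intro subfield_closed[OF G'] xv)+
    then show ?thesis by blast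
  qed
  ultimately have zw: "{z, w} \<subseteq> ?T" by blast
  obtain e :: "'k ratfun_closure" where e: "e ^ 2 = - 1"
    using nth_root_exists[of 2 "- 1 :: 'k ratfun_closure"] by auto
  have "e \<in> ?K"
  proof (rule alg_constants_root)
    show "[:1, 0, 1:] \<in> polys_over ?K" by (intro polys_over_closed[OF K] subfield_closed[OF K])
    show "poly [:1, 0, 1:] e = 0" using e by (simp add: power2_eq_square)
  qed simp
  have "u \<in> ?M" "t \<in> ?M" using ut G_eq by blast+
  then show False
    using hyperelliptic_not_superelliptic[OF K tr P \<open>squarefree P\<close> \<open>degree P = 2 * m\<close> w two m _
        \<open>u \<notin> ?K\<close> _ eq \<open>e \<in> ?K\<close> e] zw by blast
qed

end
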